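(* Let $X$ be an ultra-log-concave random variable whose mean $\mathbb{E}X$ is an integer. Then $$\mathbb{P}(X=\mathbb{E}X)\;\geq\;\mathbb{P}\big(\mathrm{Pois}(\mathbb{E}X)=\mathbb{E}X\big).$$
   Context: A sequence $(a(n))_{n\geq 0}$ of nonnegative real numbers is log-concave if $\{n\geq 0: a(n)>0\}$ is a discrete interval (a set of consecutive integers, possibly infinite) and $a(n)^2\geq a(n+1)a(n-1)$ for all $n\geq 1$. For $\lambda>0$, $\mathrm{Pois}(\lambda)$ denotes a Poisson random variable with parameter $\lambda$, whose probability mass function is $\Pi_\lambda(n)=e^{-\lambda}\frac{\lambda^n}{n!}$, $n=0,1,2,\ldots$; $\mathrm{Pois}(0)$ is the constant $0$. A random variable $X$ with values in $\{0,1,2,\ldots\}$ and probability mass function $\mu$ is called ultra-log-concave if the sequence $n\mapsto \mu(n)/\Pi_\lambda(n)$ is log-concave; this condition does not depend on $\lambda>0$ and is equivalent to log-concavity of $n\mapsto n!\,\mu(n)$. *)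

theory Defs
  imports "HOL-Probability.Probability"
begin

definition discrete_interval :: "nat set \<Rightarrow> bool" where
  "discrete_interval S \<longleftrightarrow> (\<forall>i\<in>S. \<forall>k\<in>S. {i..k} \<subseteq> S)"

definition log_concave :: "(nat \<Rightarrow> real) \<Rightarrow> bool" where
  "log_concave a \<longleftrightarrow>
     (\<forall>n. a n \<ge> 0) \<and>
     discrete_interval {n. a n > 0} \<and>
     (\<forall>n\<ge>1. (a n)\<^sup>2 \<ge> a (n + 1) * a (n - 1))"

text \<open>The choice of \<open>t\<close> is immaterial, see \<open>ultra_log_concave_iff_poisson\<close> below.\<close>

definition ultra_log_concave :: "'a measure \<Rightarrow> ('a \<Rightarrow> nat) \<Rightarrow> bool" where
  "ultra_log_concave M X \<longleftrightarrow>
     (\<forall>t>0. log_concave (\<lambda>n. \<P>(\<omega> in M. X \<omega> = n) / pmf (poisson_pmf t) n))"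

text \<open>The library's \<open>poisson_pmf\<close> is meaningful only for positive rates; rate \<open>0\<close> gives the
  constant \<open>0\<close>. Negative rates are irrelevant.\<close>

definition Pois :: "real \<Rightarrow> nat pmf" where
  "Pois r = (if r = 0 then return_pmf 0 else poisson_pmf r)"

lemma log_concave_geometric:
  fixes c r :: real
  assumes "c > 0" "r > 0"
  shows "log_concave (\<lambda>n. c * r ^ n * a n) \<longleftrightarrow> log_concave a"
proof -
  have pos: "c * r ^ n > 0" for n
    using assms by simp
  have quad: "(c * r ^ (n + 1) * a (n + 1)) * (c * r ^ (n - 1) * a (n - 1)) \<le> (c * r ^ n * a n)\<^sup>2
          \<longleftrightarrow> a (n + 1) * a (n - 1) \<le> (a n)\<^sup>2" if "n \<ge> 1" for n
  proof -
    from that obtain m where n: "n = Suc m" by (cases n) auto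
    have "(c * r ^ (n + 1) * a (n + 1)) * (c * r ^ (n - 1) * a (n - 1))
            = (c * r ^ n)\<^sup>2 * (a (n + 1) * a (n - 1))"
      by (simp add: n power2_eq_square)
    then show ?thesis
      using mult_le_cancel_left_pos[OF zero_less_power[OF pos[of n]]]
      by (simp only: power_mult_distrib[of "c * r ^ n" "a n"])
  qed
  have "c * r ^ n * a n \<ge> 0 \<longleftrightarrow> a n \<ge> 0" "c * r ^ n * a n > 0 \<longleftrightarrow> a n > 0" for n
    by (rule zero_le_mult_iff[THEN trans], use pos[of n] in linarith)
       (rule zero_less_mult_iff[THEN trans], use pos[of n] in linarith)
  then show ?thesis
    unfolding log_concave_def by (simp only: quad cong: imp_cong)
qed

lemma log_concave_div_poisson_iff:
  assumes "t > 0"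
  shows "log_concave (\<lambda>n. \<mu> n / pmf (poisson_pmf t) n) \<longleftrightarrow> log_concave (\<lambda>n. fact n * \<mu> n)"
proof -
  have "\<mu> n / pmf (poisson_pmf t) n = exp t * (1 / t) ^ n * (fact n * \<mu> n)" for n
    unfolding pmf_poisson[OF assms] exp_minus power_one_over by (simp add: divide_inverse)
  then show ?thesis
    using log_concave_geometric[of "exp t" "1 / t" "\<lambda>n. fact n * \<mu> n"] assms
    by (simp only: exp_gt_zero zero_less_divide_1_iff simp_thms)
qed

lemma ultra_log_concave_iff_fact:
  "ultra_log_concave M X \<longleftrightarrow> log_concave (\<lambda>n. fact n * \<P>(\<omega> in M. X \<omega> = n))"
  (is "_ \<longleftrightarrow> ?Q")
proof -
  have "log_concave (\<lambda>n. \<P>(\<omega> in M. X \<omega> = n) / pmf (poisson_pmf t) n) \<longleftrightarrow> ?Q" if "t > 0" for t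
    using that by (rule log_concave_div_poisson_iff)
  then show ?thesis
    unfolding ultra_log_concave_def using zero_less_one[where 'a = real] by blast
qed

lemma ultra_log_concave_iff_poisson:
  assumes "t > 0"
  shows "ultra_log_concave M X \<longleftrightarrow>
           log_concave (\<lambda>n. \<P>(\<omega> in M. X \<omega> = n) / pmf (poisson_pmf t) n)"
  unfolding ultra_log_concave_iff_fact log_concave_div_poisson_iff[OF assms] by (rule refl)

end

theory Submission
  imports Defs
begin

text \<open>Write \<open>p\<close> for the law of \<open>X\<close>, \<open>m\<close> for its mean, \<open>q\<close> for the Poisson law with the same
  mean, and \<open>f n = pmf p n / pmf q n\<close>.  The claim is \<open>f m \<ge> 1\<close>.  It follows by bounding the
  relative entropy \<open>D(p || q) = E\<^sub>p (ln f)\<close> from both sides.  It is nonnegative (Gibbs), and, since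
  \<open>ln f\<close> is concave on its support and \<open>m\<close> is both the mean of \<open>p\<close> and an integer, Jensen's
  inequality gives \<open>E\<^sub>p (ln f) \<le> ln (f m)\<close>.  Hence \<open>ln (f m) \<ge> 0\<close>.

  Both bounds are taken term by term, before summation, so that the convergence of the entropy
  is no issue.  Gibbs' inequality comes from
  \<open>ln y \<ge> 1 - 1 / y\<close>, and Jensen's from a supporting line of \<open>ln f\<close> at \<open>m\<close>, which in
  multiplicative form is a geometric sequence lying above \<open>f\<close> and touching it at \<open>m\<close>
  (\<open>log_concave_geometric_majorant\<close>).  The two combine into one inequality for each \<open>n\<close>, and
  summing it over \<open>n\<close> leaves \<open>0 \<le> ln (f m)\<close> (\<open>pmf_ratio_at_mean\<close>).

  The line is available only if \<open>f m > 0\<close>, which holds because the support is an interval and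
  the mean cannot lie strictly to one side of it.  The mean itself exists because the
  same majorant, applied to \<open>n! \<cdot> pmf p n\<close>, bounds the law by a multiple of \<open>r\<^sup>n / n!\<close>.  For
  \<open>m = 0\<close>, where \<open>q\<close> is a point mass and \<open>f\<close> makes no sense, \<open>p\<close> is that same point mass.\<close>

section \<open>Supporting lines of log-concave sequences\<close>

text \<open>The ratios \<open>f (n + 1) / f n\<close> decrease; cross-multiplied, this also covers zeros of \<open>f\<close>,
  and there the interval condition on the support is what excludes a zero between \<open>i\<close> and
  \<open>j + 1\<close> when both ends are positive.\<close>

lemma log_concave_cross:
  assumes lc: "log_concave f" and "i \<le> j"
  shows "f i * f (Suc j) \<le> f (Suc i) * f j"
  using \<open>i \<le> j\<close>
proof (induction j rule: dec_induct)
  case base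
  show ?case by simp
next
  case (step j)
  have nn: "f n \<ge> 0" for n
    using lc by (simp add: log_concave_def)
  show ?case
  proof (cases "f i > 0 \<and> f (Suc (Suc j)) > 0")
    case True
    then have "{i..Suc (Suc j)} \<subseteq> {n. f n > 0}"
      using lc unfolding log_concave_def discrete_interval_def by blast
    with step(1) have pos: "f j > 0"
      by (auto simp: subset_iff)
    have quad: "f (Suc (Suc j)) * f j \<le> (f (Suc j))\<^sup>2"
    proof -
      have "\<forall>n\<ge>1. (f n)\<^sup>2 \<ge> f (n + 1) * f (n - 1)"
        using lc by (simp add: log_concave_def)
      from this[rule_format, of "Suc j"] show ?thesis
        by simp
    qed
    have "(f i * f (Suc (Suc j))) * f j \<le> (f i * f (Suc j)) * f (Suc j)"
      using mult_left_mono[OF quad nn[of i]] by (simp add: power2_eq_square algebra_simps)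
    also have "\<dots> \<le> (f (Suc i) * f j) * f (Suc j)"
      using step.IH nn by (intro mult_right_mono)
    finally have "(f i * f (Suc (Suc j))) * f j \<le> (f (Suc i) * f (Suc j)) * f j"
      by (simp add: algebra_simps)
    with pos show ?thesis
      by (simp add: mult_le_cancel_right)
  next
    case False
    with nn have "f i * f (Suc (Suc j)) = 0"
      by (metis less_eq_real_def mult_eq_0_iff)
    with nn[of "Suc i"] nn[of "Suc j"] show ?thesis
      by (metis mult_nonneg_nonneg)
  qed
qed

lemma below_geometric:
  fixes f :: "nat \<Rightarrow> real"
  assumes r: "r > 0"
    and up: "\<And>n. n \<ge> m \<Longrightarrow> f (Suc n) \<le> r * f n"
    and down: "\<And>n. n < m \<Longrightarrow> r * f n \<le> f (Suc n)"
  shows "f n * r ^ m \<le> f m * r ^ n"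
proof (cases "m \<le> n")
  case True
  then show ?thesis
  proof (induction n rule: dec_induct)
    case (step n)
    have "f (Suc n) * r ^ m \<le> r * (f n * r ^ m)"
      using mult_right_mono[OF up[OF step(1)], of "r ^ m"] r by (simp add: mult.assoc)
    also have "\<dots> \<le> r * (f m * r ^ n)"
      using step.IH r by simp
    finally show ?case
      by (simp add: algebra_simps)
  qed simp
next
  case False
  then have "n \<le> m" by simp
  then show ?thesis
  proof (induction n rule: inc_induct)
    case (step n)
    have "r * (f n * r ^ m) \<le> f (Suc n) * r ^ m"
      using mult_right_mono[OF down[OF step(2)], of "r ^ m"] r by (simp add: mult.assoc)
    also have "\<dots> \<le> r * (f m * r ^ n)"
      using step.IH by (simp add: algebra_simps)
    finally show ?case
      using r by simp
  qed simp
qed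

text \<open>The supporting line of the concave function \<open>ln f\<close> at \<open>m\<close>, exponentiated.  Its slope is
  the logarithm of the ratio of \<open>f\<close> on either side of \<open>m\<close>, whichever is finite and nonzero.\<close>

lemma log_concave_geometric_majorant:
  assumes lc: "log_concave f" and fm: "f m > 0"
  obtains r :: real where "r > 0" "\<And>n. f n * r ^ m \<le> f m * r ^ n"
proof -
  have nn: "f n \<ge> 0" for n
    using lc by (simp add: log_concave_def)
  note cross = log_concave_cross[OF lc]
  show thesis
  proof (cases "f (Suc m) > 0")
    case True
    define r where "r = f (Suc m) / f m"
    have r: "r > 0"
      using True fm by (simp add: r_def)
    have up: "f (Suc n) \<le> r * f n" if "n \<ge> m" for n
      using cross[OF that] fm by (simp add: r_def pos_le_divide_eq mult.commute)
    have down: "r * f n \<le> f (Suc n)" if "n < m" for n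
      using cross[of n m] that fm by (simp add: r_def pos_divide_le_eq mult.commute)
    show thesis
      using that[OF r below_geometric[of r m f, OF r up down]] .
  next
    case False
    show thesis
    proof (cases "\<exists>l. m = Suc l \<and> f l > 0")
      case True
      then obtain l where l: "m = Suc l" "f l > 0" by blast
      define r where "r = f m / f l"
      have r: "r > 0"
        using l fm by (simp add: r_def)
      have up: "f (Suc n) \<le> r * f n" if "n \<ge> m" for n
        using cross[of l n] that l by (simp add: r_def pos_le_divide_eq mult.commute)
      have down: "r * f n \<le> f (Suc n)" if "n < m" for n
        using cross[of n l] that l by (simp add: r_def pos_divide_le_eq mult.commute)
      show thesis
        using that[OF r below_geometric[of r m f, OF r up down]] .
    next
      (* f vanishes at every neighbour of m, so m is the whole support and any slope will do. *)
      case isolated: False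
      have int: "{i..j} \<subseteq> {n. f n > 0}" if "f i > 0" "f j > 0" for i j
        using lc that unfolding log_concave_def discrete_interval_def by blast
      have zero: "f n = 0" if "n \<noteq> m" for n
      proof (rule ccontr)
        assume "f n \<noteq> 0"
        with nn[of n] have fn: "f n > 0" by simp
        show False
        proof (cases "n < m")
          case True
          then obtain l where l: "m = Suc l" "n \<le> l"
            by (cases m) auto
          then have "l \<in> {n..m}" by simp
          with int[OF fn fm] have "f l > 0" by blast
          with isolated l show False by blast
        next
          case False
          with that have "Suc m \<in> {m..n}" by simp
          with int[OF fm fn] \<open>\<not> f (Suc m) > 0\<close> show False by blast
        qed
      qed
      have "f n \<le> f m" for n
        using zero[of n] fm by (cases "n = m") simp_all
      then show thesis
        by (intro that[of 1]) simp_all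
    qed
  qed
qed

section \<open>The mean and the support of a law on the naturals\<close>

lemma pmf_times_sums_expectation:
  fixes g :: "nat \<Rightarrow> real"
  assumes "integrable (measure_pmf p) g"
  shows "(\<lambda>n. pmf p n * g n) sums measure_pmf.expectation p g"
proof -
  have "integrable (count_space UNIV) (\<lambda>n. pmf p n * g n)"
    using assms by (simp add: measure_pmf_eq_density integrable_density)
  moreover have "measure_pmf.expectation p g = (LINT n|count_space UNIV. pmf p n * g n)"
    by (simp add: measure_pmf_eq_density integral_density)
  ultimately show ?thesis
    using sums_integral_count_space_nat[of "\<lambda>n. pmf p n * g n"] by (simp only:)
qed

text \<open>The Bochner integral of a non-integrable function is \<open>0\<close>, so without this fact an expectation
  of \<open>0\<close> would say nothing about the law.\<close>

lemma fact_log_concave_integrable: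
  assumes lc: "log_concave (\<lambda>n. fact n * pmf p n)"
  shows "integrable (measure_pmf p) real"
proof -
  obtain m where "pmf p m > 0"
    using set_pmf_not_empty[of p] by (auto simp: set_pmf_eq')
  then have "fact m * pmf p m > 0" by simp
  then obtain r where r: "r > 0"
    and le: "\<And>n. fact n * pmf p n * r ^ m \<le> fact m * pmf p m * r ^ n"
    using log_concave_geometric_majorant[OF lc] by blast
  define C where "C = fact m * pmf p m / r ^ m"
  have bound: "pmf p n \<le> C * (r ^ n / fact n)" for n
    using le[of n] r by (simp add: C_def field_simps)
  have "summable (\<lambda>n. pmf p n * real n)"
  proof (rule summable_comparison_test'[where N = 1])
    have "summable (\<lambda>n. r ^ n / fact n)"
      using summable_exp[of r] by (simp add: divide_inverse mult.commute)
    then have "summable (\<lambda>n. C * r * (r ^ (n - 1) / fact (n - 1)))"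
      by (subst summable_Suc_iff[symmetric]) (simp only: diff_Suc_1 summable_mult)
    then show "summable (\<lambda>n. C * r * (r ^ (n - 1) / fact (n - 1)))" .
    fix n :: nat assume "n \<ge> 1"
    then obtain l where l: "n = Suc l" by (cases n) auto
    have "pmf p n * real n \<le> C * (r ^ n / fact n) * real n"
      using bound by (intro mult_right_mono) auto
    also have "\<dots> = C * r * (r ^ (n - 1) / fact (n - 1))"
      by (simp add: l fact_Suc [where 'a = real] nonzero_mult_divide_mult_cancel_left
          del: of_nat_Suc)
    finally show "norm (pmf p n * real n) \<le> C * r * (r ^ (n - 1) / fact (n - 1))"
      by simp
  qed
  then have "integrable (count_space UNIV) (\<lambda>n. pmf p n * real n)"
    by (simp add: integrable_count_space_nat_iff)
  then show ?thesis
    by (simp add: measure_pmf_eq_density integrable_density)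
qed

lemma support_on_one_side_of_mean:
  assumes int: "integrable (measure_pmf p) real"
    and mean: "measure_pmf.expectation p real = real m"
    and side: "(\<forall>n\<in>set_pmf p. n \<le> m) \<or> (\<forall>n\<in>set_pmf p. m \<le> n)"
  shows "set_pmf p = {m}"
proof -
  (* The sign that makes the centred variable nonnegative, so that its zero mean forces it to vanish. *)
  define s :: real where "s = (if \<forall>n\<in>set_pmf p. m \<le> n then 1 else -1)"
  have s: "s \<noteq> 0" "\<And>n. n \<in> set_pmf p \<Longrightarrow> 0 \<le> s * (real n - real m)"
    using side by (auto simp: s_def)
  have "measure_pmf.expectation p (\<lambda>n. s * (real n - real m)) = 0"
    using int mean by simp
  moreover have "integrable (measure_pmf p) (\<lambda>n. s * (real n - real m))"
    using int by simp
  moreover have "AE n in measure_pmf p. 0 \<le> s * (real n - real m)"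
    using s by (simp add: AE_measure_pmf_iff)
  ultimately have "AE n in measure_pmf p. s * (real n - real m) = 0"
    using integral_nonneg_eq_0_iff_AE by blast
  with s(1) have "set_pmf p \<subseteq> {m}"
    by (auto simp: AE_measure_pmf_iff)
  with set_pmf_not_empty[of p] show ?thesis by blast
qed

lemma interval_support_contains_mean:
  assumes "discrete_interval (set_pmf p)"
    and "integrable (measure_pmf p) real"
    and "measure_pmf.expectation p real = real m"
  shows "m \<in> set_pmf p"
proof (rule ccontr)
  assume "m \<notin> set_pmf p"
  then have "\<not> (i \<le> m \<and> m \<le> j)" if "i \<in> set_pmf p" "j \<in> set_pmf p" for i j
    using assms(1) that unfolding discrete_interval_def by (meson atLeastAtMost_iff subsetD)
  then have "(\<forall>n\<in>set_pmf p. n \<le> m) \<or> (\<forall>n\<in>set_pmf p. m \<le> n)"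
    by (meson nle_le)
  from support_on_one_side_of_mean[OF assms(2,3) this] \<open>m \<notin> set_pmf p\<close> show False by simp
qed

section \<open>Comparison at the mean\<close>

text \<open>Jensen's upper bound and Gibbs' lower bound for the relative entropy of \<open>p\<close> and \<open>q\<close>.  The
  slope term of the supporting line at \<open>m\<close> averages to zero because \<open>m\<close> is the mean of \<open>p\<close>.\<close>

lemma pmf_ratio_at_mean:
  fixes p q :: "nat pmf"
  assumes q: "\<And>n. pmf q n > 0"
    and lc: "log_concave (\<lambda>n. pmf p n / pmf q n)"
    and int: "integrable (measure_pmf p) real"
    and mean: "measure_pmf.expectation p real = real m"
  shows "pmf q m \<le> pmf p m"
proof -
  define f where "f n = pmf p n / pmf q n" for n
  have f_pos_iff: "f n > 0 \<longleftrightarrow> n \<in> set_pmf p" for n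
    using q[of n] by (simp add: f_def zero_less_divide_iff pmf_positive_iff)
  have "discrete_interval {n. f n > 0}"
    using lc by (simp add: log_concave_def f_def)
  then have "m \<in> set_pmf p"
    using int mean by (intro interval_support_contains_mean) (simp_all add: f_pos_iff)
  then have fm: "f m > 0" by (simp add: f_pos_iff)
  have "log_concave f"
    using lc by (simp add: f_def [abs_def])
  then obtain r where r: "r > 0" and majorant: "\<And>n. f n * r ^ m \<le> f m * r ^ n"
    using log_concave_geometric_majorant fm by blast
  (* On the support, pmf p n * ln (f n), the summand of the entropy, lies between the two sides. *)
  have pointwise: "pmf p n * 1 - pmf q n * 1 \<le> pmf p n * (ln (f m) + (real n - real m) * ln r)" for n
  proof (cases "n \<in> set_pmf p")
    case True
    then have fn: "f n > 0" by (simp add: f_pos_iff)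
    have "ln (f n * r ^ m) \<le> ln (f m * r ^ n)"
      using majorant[of n] fm fn r by (subst ln_le_cancel_iff) auto
    then have line: "ln (f n) \<le> ln (f m) + (real n - real m) * ln r"
      using fm fn r by (simp add: ln_mult ln_realpow algebra_simps)
    have "1 - 1 / f n \<le> ln (f n)"
      using ln_le_minus_one[of "1 / f n"] fn by (simp add: ln_div)
    with line have "pmf p n * (1 - 1 / f n) \<le> pmf p n * (ln (f m) + (real n - real m) * ln r)"
      by (intro mult_left_mono) auto
    moreover have "pmf p n * (1 - 1 / f n) = pmf p n - pmf q n"
      using True q[of n] by (simp add: f_def set_pmf_iff field_simps)
    ultimately show ?thesis by simp
  next
    case False
    then show ?thesis
      by (simp add: set_pmf_iff)
  qed
  have E: "measure_pmf.expectation p (\<lambda>n. ln (f m) + (real n - real m) * ln r) = ln (f m)"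
    using int mean by simp
  have "(\<lambda>n. pmf p n * (ln (f m) + (real n - real m) * ln r)) sums ln (f m)"
    using pmf_times_sums_expectation[of p "\<lambda>n. ln (f m) + (real n - real m) * ln r"] int
    unfolding E by simp
  moreover have "(\<lambda>n. pmf p n * 1 - pmf q n * 1) sums (1 - 1)"
    using pmf_times_sums_expectation[of p "\<lambda>_. 1"] pmf_times_sums_expectation[of q "\<lambda>_. 1"]
    by (intro sums_diff) simp_all
  ultimately have "0 \<le> ln (f m)"
    using sums_le[OF pointwise] by simp
  then have "1 \<le> f m"
    using fm by simp
  then show ?thesis
    using q[of m] by (simp add: f_def)
qed

lemma pmf_at_mean_ge_Pois:
  assumes lc: "log_concave (\<lambda>n. fact n * pmf p n)"
    and mean: "measure_pmf.expectation p real = real m"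
  shows "pmf (Pois (real m)) m \<le> pmf p m"
proof (cases "m = 0")
  case True
  then have "set_pmf p = {m}"
    using support_on_one_side_of_mean[OF fact_log_concave_integrable[OF lc] mean] by simp
  then have "p = return_pmf m"
    by (metis order_refl set_pmf_subset_singleton)
  then show ?thesis
    by (simp add: pmf_le_1)
next
  case False
  then have m: "real m > 0" by simp
  have "log_concave (\<lambda>n. pmf p n / pmf (poisson_pmf (real m)) n)"
    using lc log_concave_div_poisson_iff[OF m] by blast
  then have "pmf (poisson_pmf (real m)) m \<le> pmf p m"
    using m mean fact_log_concave_integrable[OF lc] by (intro pmf_ratio_at_mean) simp_all
  with False show ?thesis
    by (simp add: Pois_def)
qed

lemma (in prob_space) law_pmf_exists:
  fixes X :: "'a \<Rightarrow> nat"
  assumes "X \<in> measurable M (count_space UNIV)"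
  obtains p where "measure_pmf p = distr M (count_space UNIV) X"
proof -
  interpret D: prob_space "distr M (count_space UNIV) X"
    using assms by (rule prob_space_distr)
  have "AE n in distr M (count_space UNIV) X. measure (distr M (count_space UNIV) X) {n} \<noteq> 0"
    by (subst D.AE_support_countable) (auto intro!: exI[of _ UNIV])
  then have "distr M (count_space UNIV) X \<in> 
      {M. prob_space M \<and> sets M = UNIV \<and> (AE x in M. measure M {x} \<noteq> 0)}"
    using D.prob_space_axioms by simp
  then have "measure_pmf (Abs_pmf (distr M (count_space UNIV) X)) = distr M (count_space UNIV) X"
    by (rule Abs_pmf_inverse)
  then show thesis by (rule that)
qed

theorem theorem2:
  fixes M :: "'a measure" and X :: "'a \<Rightarrow> nat"
  assumes "prob_space M"
    and "X \<in> measurable M (count_space UNIV)"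
    and "ultra_log_concave M X"
    and "(LINT \<omega>|M. real (X \<omega>)) \<in> \<int>"
  shows "\<P>(\<omega> in M. real (X \<omega>) = (LINT \<omega>'|M. real (X \<omega>')))
           \<ge> \<P>(k in measure_pmf (Pois (LINT \<omega>|M. real (X \<omega>))). real k = (LINT \<omega>|M. real (X \<omega>)))"
proof -
  interpret prob_space M by fact
  note [measurable] = assms(2)
  obtain p where p: "measure_pmf p = distr M (count_space UNIV) X"
    using law_pmf_exists[OF assms(2)] .
  have pmf_p: "\<P>(\<omega> in M. X \<omega> = n) = pmf p n" for n
  proof -
    have "pmf p n = measure (distr M (count_space UNIV) X) {n}"
      unfolding p[symmetric] by (rule measure_pmf_single[symmetric])
    also have "\<dots> = \<P>(\<omega> in M. X \<omega> = n)"
      by (subst measure_distr) (auto intro!: arg_cong[where f = "measure M"])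
    finally show ?thesis by simp
  qed
  have E: "measure_pmf.expectation p real = (LINT \<omega>|M. real (X \<omega>))"
    unfolding p by (subst integral_distr) simp_all
  have "(LINT \<omega>|M. real (X \<omega>)) \<ge> 0"
    by simp
  with assms(4) obtain m :: nat where m: "(LINT \<omega>|M. real (X \<omega>)) = real m"
    by (metis Ints_cases of_int_0_le_iff of_int_of_nat_eq zero_le_imp_eq_int)
  have "log_concave (\<lambda>n. fact n * pmf p n)"
    using assms(3) by (simp add: ultra_log_concave_iff_fact pmf_p)
  then have "pmf (Pois (real m)) m \<le> pmf p m"
    using E m by (intro pmf_at_mean_ge_Pois) simp_all
  moreover have "{k. real k = real m} = {m}"
    by auto
  ultimately show ?thesis
    unfolding m of_nat_eq_iff pmf_p by (simp add: measure_pmf_single)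
qed

end
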